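(* Let $\mathrm{L}$ be a semilinear core expansion of $\mathrm{MTL}$. Then: 1. $\mathrm{L}$ is explosive (i.e. $\varphi,\neg\varphi\vdash_{\mathrm L}\psi$ for all formulas $\varphi,\psi$), and hence it is not paraconsistent. 2. The degree-preserving companion $\mathrm{L}^{\leq}$ is paraconsistent (i.e. $\varphi,\neg\varphi\nvdash_{\mathrm L^{\leq}}\psi$ for some formulas $\varphi,\psi$) if and only if $\mathrm{L}$ is not pseudo-complemented, i.e. if and only if $\mathrm{L}$ does not prove the law $\neg(\varphi\wedge\neg\varphi)$.
   Context: $\mathrm{MTL}$: formulas are built from countably many propositional variables with binary connectives $\wedge,\&,\to$ and the constant $\overline 0$; $\neg\varphi:=\varphi\to\overline 0$, $\overline 1:=\neg\overline 0$, $\varphi\vee\psi:=((\varphi\to\psi)\to\psi)\wedge((\psi\to\varphi)\to\varphi)$, $\varphi\leftrightarrow\psi:=(\varphi\to\psi)\wedge(\psi\to\varphi)$. Its axiom schemata are $(\varphi\to\psi)\to((\psi\to\chi)\to(\varphi\to\chi))$; $\varphi\&\psi\to\varphi$; $\varphi\&\psi\to\psi\&\varphi$; $\varphi\wedge\psi\to\varphi$; $\varphi\wedge\psi\to\psi\wedge\varphi$; $\varphi\&(\varphi\to\psi)\to\varphi\wedge\psi$; $(\varphi\to(\psi\to\chi))\to(\varphi\&\psi\to\chi)$; $(\varphi\&\psi\to\chi)\to(\varphi\to(\psi\to\chi))$; $((\varphi\to\psi)\to\chi)\to(((\psi\to\varphi)\to\chi)\to\chi)$; $\overline 0\to\varphi$;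 its only rule is modus ponens. An $\mathrm{MTL}$-algebra is a commutative bounded integral residuated lattice $\langle A,\wedge,\vee,\&,\to,0,1\rangle$ with $(x\to y)\vee(y\to x)=1$. A core expansion of $\mathrm{MTL}$ is a finitary logic $\mathrm L$ obtained from $\mathrm{MTL}$ by possibly adding new connectives, axiom schemata and finitary rule schemata, such that for each new $n$-ary connective $c$ and each argument place, $\varphi\to\psi,\psi\to\varphi\vdash_{\mathrm L}c(\ldots,\varphi,\ldots)\to c(\ldots,\psi,\ldots)$. An $\mathrm L$-algebra is an $\mathrm{MTL}$-algebra with operations interpreting the new connectives such that, under every evaluation, all axioms of $\mathrm L$ get value $1$ and all rules of $\mathrm L$ preserve the value $1$. An $\mathrm L$-chain is a linearly ordered $\mathrm L$-algebra. $\mathrm L$ is semilinear if it is strongly complete w.r.t. $\mathrm L$-chains: $\Gamma\vdash_{\mathrm L}\varphi$ iff for every $\mathrm L$-chain and every evaluation $e$ into it, $e(\gamma)=1$ for all $\gamma\in\Gamma$ implies $e(\varphi)=1$. Degree-preserving companion $\mathrm L^{\leq}$: $\Gamma\vdash_{\mathrm L^{\leq}}\varphi$ iff for every $\mathrm L$-chain $\boldsymbol A$, every $a\in A$ and every $\boldsymbol A$-evaluation $v$, if $a\leq v(\psi)$ for every $\psi\in\Gamma$ then $a\leq v(\varphi)$. *)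

theory Defs
  imports Main
begin

section \<open>Syntax\<close>

datatype 'c fm =
    Var nat
  | Zero  (\<open>\<^bold>0\<close>)
  | And "'c fm" "'c fm"  (infixr \<open>\<^bold>\<and>\<close> 65)
  | Fus "'c fm" "'c fm"  (infixr \<open>\<^bold>&\<close> 67)
  | Imp "'c fm" "'c fm"  (infixr \<open>\<^bold>\<rightarrow>\<close> 55)
  | Conn 'c "'c fm list"

abbreviation Neg :: "'c fm \<Rightarrow> 'c fm"  (\<open>\<^bold>\<not> _\<close> [70] 70)
  where "\<^bold>\<not> \<phi> \<equiv> \<phi> \<^bold>\<rightarrow> \<^bold>0"

primrec subst :: "(nat \<Rightarrow> 'c fm) \<Rightarrow> 'c fm \<Rightarrow> 'c fm" where
  "subst \<sigma> (Var n) = \<sigma> n"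
| "subst \<sigma> \<^bold>0 = \<^bold>0"
| "subst \<sigma> (\<phi> \<^bold>\<and> \<psi>) = subst \<sigma> \<phi> \<^bold>\<and> subst \<sigma> \<psi>"
| "subst \<sigma> (\<phi> \<^bold>& \<psi>) = subst \<sigma> \<phi> \<^bold>& subst \<sigma> \<psi>"
| "subst \<sigma> (\<phi> \<^bold>\<rightarrow> \<psi>) = subst \<sigma> \<phi> \<^bold>\<rightarrow> subst \<sigma> \<psi>"
| "subst \<sigma> (Conn c \<phi>s) = Conn c (map (subst \<sigma>) \<phi>s)"

text \<open>An expansion of MTL is presented by its new connectives with their arities and its new
  axiom and rule schemata. A schema is a formula (a pair of a set of premises and a conclusion)
  whose propositional variables serve as metavariables, to be replaced by arbitrary formulas.
  The set of new connectives is a subset of the type \<open>'c\<close>, as it may be empty.\<close>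

record 'c logic =
  conns :: "'c set"
  arity :: "'c \<Rightarrow> nat"
  new_axioms :: "'c fm set"
  new_rules :: "('c fm set \<times> 'c fm) set"

inductive_set formulas :: "'c logic \<Rightarrow> 'c fm set" for L :: "'c logic" where
  Var: "Var n \<in> formulas L"
| Zero: "\<^bold>0 \<in> formulas L"
| And: "\<phi> \<in> formulas L \<Longrightarrow> \<psi> \<in> formulas L \<Longrightarrow> \<phi> \<^bold>\<and> \<psi> \<in> formulas L"
| Fus: "\<phi> \<in> formulas L \<Longrightarrow> \<psi> \<in> formulas L \<Longrightarrow> \<phi> \<^bold>& \<psi> \<in> formulas L"
| Imp: "\<phi> \<in> formulas L \<Longrightarrow> \<psi> \<in> formulas L \<Longrightarrow> \<phi> \<^bold>\<rightarrow> \<psi> \<in> formulas L"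
| Conn: "c \<in> conns L \<Longrightarrow> length \<phi>s = arity L c \<Longrightarrow> (\<And>\<phi>. \<phi> \<in> set \<phi>s \<Longrightarrow> \<phi> \<in> formulas L)
    \<Longrightarrow> Conn c \<phi>s \<in> formulas L"

section \<open>Logics\<close>

definition mtl_axioms :: "'c fm set" where
  "mtl_axioms = (let \<phi> = Var 0; \<psi> = Var 1; \<chi> = Var 2 in
   {(\<phi> \<^bold>\<rightarrow> \<psi>) \<^bold>\<rightarrow> ((\<psi> \<^bold>\<rightarrow> \<chi>) \<^bold>\<rightarrow> (\<phi> \<^bold>\<rightarrow> \<chi>)),
    (\<phi> \<^bold>& \<psi>) \<^bold>\<rightarrow> \<phi>,
    (\<phi> \<^bold>& \<psi>) \<^bold>\<rightarrow> (\<psi> \<^bold>& \<phi>),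
    (\<phi> \<^bold>\<and> \<psi>) \<^bold>\<rightarrow> \<phi>,
    (\<phi> \<^bold>\<and> \<psi>) \<^bold>\<rightarrow> (\<psi> \<^bold>\<and> \<phi>),
    (\<phi> \<^bold>& (\<phi> \<^bold>\<rightarrow> \<psi>)) \<^bold>\<rightarrow> (\<phi> \<^bold>\<and> \<psi>),
    (\<phi> \<^bold>\<rightarrow> (\<psi> \<^bold>\<rightarrow> \<chi>)) \<^bold>\<rightarrow> ((\<phi> \<^bold>& \<psi>) \<^bold>\<rightarrow> \<chi>),
    ((\<phi> \<^bold>& \<psi>) \<^bold>\<rightarrow> \<chi>) \<^bold>\<rightarrow> (\<phi> \<^bold>\<rightarrow> (\<psi> \<^bold>\<rightarrow> \<chi>)),
    ((\<phi> \<^bold>\<rightarrow> \<psi>) \<^bold>\<rightarrow> \<chi>) \<^bold>\<rightarrow> (((\<psi> \<^bold>\<rightarrow> \<phi>) \<^bold>\<rightarrow> \<chi>) \<^bold>\<rightarrow> \<chi>),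
    \<^bold>0 \<^bold>\<rightarrow> \<phi>})"

definition modus_ponens :: "'c fm set \<times> 'c fm" where
  "modus_ponens = ({Var 0, Var 0 \<^bold>\<rightarrow> Var 1}, Var 1)"

definition axioms :: "'c logic \<Rightarrow> 'c fm set" where
  "axioms L = mtl_axioms \<union> new_axioms L"

definition rules :: "'c logic \<Rightarrow> ('c fm set \<times> 'c fm) set" where
  "rules L = insert modus_ponens (new_rules L)"

inductive derives :: "'c logic \<Rightarrow> 'c fm set \<Rightarrow> 'c fm \<Rightarrow> bool"
  for L :: "'c logic" and \<Gamma> :: "'c fm set" where
  hyp: "\<phi> \<in> \<Gamma> \<Longrightarrow> derives L \<Gamma> \<phi>"
| ax: "\<phi> \<in> axioms L \<Longrightarrow> range \<sigma> \<subseteq> formulas L \<Longrightarrow> derives L \<Gamma> (subst \<sigma> \<phi>)"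
| rule: "(\<Pi>, \<phi>) \<in> rules L \<Longrightarrow> range \<sigma> \<subseteq> formulas L
    \<Longrightarrow> (\<And>\<psi>. \<psi> \<in> \<Pi> \<Longrightarrow> derives L \<Gamma> (subst \<sigma> \<psi>)) \<Longrightarrow> derives L \<Gamma> (subst \<sigma> \<phi>)"

definition core_expansion :: "'c logic \<Rightarrow> bool" where
  "core_expansion L \<longleftrightarrow>
     new_axioms L \<subseteq> formulas L \<and>
     (\<forall>(\<Pi>, \<phi>) \<in> new_rules L. finite \<Pi> \<and> \<Pi> \<subseteq> formulas L \<and> \<phi> \<in> formulas L) \<and>
     (\<forall>c \<in> conns L. \<forall>\<alpha>s \<in> lists (formulas L). \<forall>\<beta>s \<in> lists (formulas L).
        \<forall>\<phi> \<in> formulas L. \<forall>\<psi> \<in> formulas L. length (\<alpha>s @ \<phi> # \<beta>s) = arity L c \<longrightarrow>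
          derives L {\<phi> \<^bold>\<rightarrow> \<psi>, \<psi> \<^bold>\<rightarrow> \<phi>} (Conn c (\<alpha>s @ \<phi> # \<beta>s) \<^bold>\<rightarrow> Conn c (\<alpha>s @ \<psi> # \<beta>s)))"

section \<open>Algebras\<close>

record ('c, 'a) algebra =
  carrier :: "'a set"
  meet :: "'a \<Rightarrow> 'a \<Rightarrow> 'a"
  join :: "'a \<Rightarrow> 'a \<Rightarrow> 'a"
  fus :: "'a \<Rightarrow> 'a \<Rightarrow> 'a"
  imp :: "'a \<Rightarrow> 'a \<Rightarrow> 'a"
  zero :: 'a
  one :: 'a
  ops :: "'c \<Rightarrow> 'a list \<Rightarrow> 'a"

definition le :: "('c, 'a) algebra \<Rightarrow> 'a \<Rightarrow> 'a \<Rightarrow> bool" where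
  "le A x y \<longleftrightarrow> meet A x y = x"

locale mtl_algebra =
  fixes A :: "('c, 'a) algebra"
  assumes closed:
      "x \<in> carrier A \<Longrightarrow> y \<in> carrier A \<Longrightarrow> meet A x y \<in> carrier A"
      "x \<in> carrier A \<Longrightarrow> y \<in> carrier A \<Longrightarrow> join A x y \<in> carrier A"
      "x \<in> carrier A \<Longrightarrow> y \<in> carrier A \<Longrightarrow> fus A x y \<in> carrier A"
      "x \<in> carrier A \<Longrightarrow> y \<in> carrier A \<Longrightarrow> imp A x y \<in> carrier A"
      "zero A \<in> carrier A"
      "one A \<in> carrier A"
    and lattice:
      "x \<in> carrier A \<Longrightarrow> y \<in> carrier A \<Longrightarrow> meet A x y = meet A y x"
      "x \<in> carrier A \<Longrightarrow> y \<in> carrier A \<Longrightarrow> join A x y = join A y x"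
      "x \<in> carrier A \<Longrightarrow> y \<in> carrier A \<Longrightarrow> z \<in> carrier A \<Longrightarrow>
         meet A (meet A x y) z = meet A x (meet A y z)"
      "x \<in> carrier A \<Longrightarrow> y \<in> carrier A \<Longrightarrow> z \<in> carrier A \<Longrightarrow>
         join A (join A x y) z = join A x (join A y z)"
      "x \<in> carrier A \<Longrightarrow> y \<in> carrier A \<Longrightarrow> meet A x (join A x y) = x"
      "x \<in> carrier A \<Longrightarrow> y \<in> carrier A \<Longrightarrow> join A x (meet A x y) = x"
    and bounds:
      "x \<in> carrier A \<Longrightarrow> le A (zero A) x"
      "x \<in> carrier A \<Longrightarrow> le A x (one A)"
    and monoid:
      "x \<in> carrier A \<Longrightarrow> y \<in> carrier A \<Longrightarrow> fus A x y = fus A y x"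
      "x \<in> carrier A \<Longrightarrow> y \<in> carrier A \<Longrightarrow> z \<in> carrier A \<Longrightarrow>
         fus A (fus A x y) z = fus A x (fus A y z)"
      "x \<in> carrier A \<Longrightarrow> fus A (one A) x = x"
    and residuation:
      "x \<in> carrier A \<Longrightarrow> y \<in> carrier A \<Longrightarrow> z \<in> carrier A \<Longrightarrow>
         le A (fus A x y) z \<longleftrightarrow> le A x (imp A y z)"
    and prelinearity:
      "x \<in> carrier A \<Longrightarrow> y \<in> carrier A \<Longrightarrow> join A (imp A x y) (imp A y x) = one A"

primrec eval :: "('c, 'a) algebra \<Rightarrow> (nat \<Rightarrow> 'a) \<Rightarrow> 'c fm \<Rightarrow> 'a" where
  "eval A e (Var n) = e n"
| "eval A e \<^bold>0 = zero A"
| "eval A e (\<phi> \<^bold>\<and> \<psi>) = meet A (eval A e \<phi>) (eval A e \<psi>)"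
| "eval A e (\<phi> \<^bold>& \<psi>) = fus A (eval A e \<phi>) (eval A e \<psi>)"
| "eval A e (\<phi> \<^bold>\<rightarrow> \<psi>) = imp A (eval A e \<phi>) (eval A e \<psi>)"
| "eval A e (Conn c \<phi>s) = ops A c (map (eval A e) \<phi>s)"

definition L_algebra :: "'c logic \<Rightarrow> ('c, 'a) algebra \<Rightarrow> bool" where
  "L_algebra L A \<longleftrightarrow>
     mtl_algebra A \<and>
     (\<forall>c \<in> conns L. \<forall>xs \<in> lists (carrier A). length xs = arity L c \<longrightarrow> ops A c xs \<in> carrier A) \<and>
     (\<forall>e. range e \<subseteq> carrier A \<longrightarrow>
        (\<forall>\<phi> \<in> axioms L. eval A e \<phi> = one A) \<and>
        (\<forall>(\<Pi>, \<phi>) \<in> rules L. (\<forall>\<psi> \<in> \<Pi>. eval A e \<psi> = one A) \<longrightarrow> eval A e \<phi> = one A))"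

definition L_chain :: "'c logic \<Rightarrow> ('c, 'a) algebra \<Rightarrow> bool" where
  "L_chain L A \<longleftrightarrow> L_algebra L A \<and> (\<forall>x \<in> carrier A. \<forall>y \<in> carrier A. le A x y \<or> le A y x)"

section \<open>Semilinearity and the degree-preserving companion\<close>

text \<open>The chains below have carriers in a type \<open>'a\<close>. The choice of \<open>'a\<close> is immaterial as soon as
  the formulas embed into it: the consequences over \<open>'a\<close> then hold in the chains over every type,
  as proved at the end of this theory.\<close>

definition chain_consequence :: "'a itself \<Rightarrow> 'c logic \<Rightarrow> 'c fm set \<Rightarrow> 'c fm \<Rightarrow> bool" where
  "chain_consequence (_ :: 'a itself) L \<Gamma> \<phi> \<longleftrightarrow>
     (\<forall>A :: ('c, 'a) algebra. L_chain L A \<longrightarrow> (\<forall>e. range e \<subseteq> carrier A \<longrightarrow>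
        (\<forall>\<gamma> \<in> \<Gamma>. eval A e \<gamma> = one A) \<longrightarrow> eval A e \<phi> = one A))"

definition semilinear :: "'a itself \<Rightarrow> 'c logic \<Rightarrow> bool" where
  "semilinear T L \<longleftrightarrow> (\<forall>\<Gamma> \<subseteq> formulas L. \<forall>\<phi> \<in> formulas L.
     derives L \<Gamma> \<phi> \<longleftrightarrow> chain_consequence T L \<Gamma> \<phi>)"

definition companion :: "'a itself \<Rightarrow> 'c logic \<Rightarrow> 'c fm set \<Rightarrow> 'c fm \<Rightarrow> bool" where
  "companion (_ :: 'a itself) L \<Gamma> \<phi> \<longleftrightarrow>
     (\<forall>A :: ('c, 'a) algebra. L_chain L A \<longrightarrow>
        (\<forall>a \<in> carrier A. \<forall>v. range v \<subseteq> carrier A \<longrightarrow>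
           (\<forall>\<psi> \<in> \<Gamma>. le A a (eval A v \<psi>)) \<longrightarrow> le A a (eval A v \<phi>)))"

definition explosive :: "'c logic \<Rightarrow> ('c fm set \<Rightarrow> 'c fm \<Rightarrow> bool) \<Rightarrow> bool" where
  "explosive L entails \<longleftrightarrow> (\<forall>\<phi> \<in> formulas L. \<forall>\<psi> \<in> formulas L. entails {\<phi>, \<^bold>\<not> \<phi>} \<psi>)"

definition paraconsistent :: "'c logic \<Rightarrow> ('c fm set \<Rightarrow> 'c fm \<Rightarrow> bool) \<Rightarrow> bool" where
  "paraconsistent L entails \<longleftrightarrow> (\<exists>\<phi> \<in> formulas L. \<exists>\<psi> \<in> formulas L. \<not> entails {\<phi>, \<^bold>\<not> \<phi>} \<psi>)"

definition pseudo_complemented :: "'c logic \<Rightarrow> bool" where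
  "pseudo_complemented L \<longleftrightarrow> (\<forall>\<phi> \<in> formulas L. derives L {} (\<^bold>\<not> (\<phi> \<^bold>\<and> \<^bold>\<not> \<phi>)))"

section \<open>Independence of the type of carriers\<close>

lemma formulas_mtl_axioms: "mtl_axioms \<subseteq> formulas L"
  by (auto simp: mtl_axioms_def Let_def intro!: formulas.intros)

lemma formulas_axioms: "core_expansion L \<Longrightarrow> axioms L \<subseteq> formulas L"
  using formulas_mtl_axioms by (auto simp: axioms_def core_expansion_def)

lemma formulas_rules:
  assumes "core_expansion L" "(\<Pi>, \<phi>) \<in> rules L"
  shows "\<Pi> \<subseteq> formulas L" "\<phi> \<in> formulas L"
  using assms
  by (auto simp: rules_def core_expansion_def modus_ponens_def intro!: formulas.intros)

definition subuniverse :: "'c logic \<Rightarrow> ('c, 'a) algebra \<Rightarrow> 'a set \<Rightarrow> bool" where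
  "subuniverse L A S \<longleftrightarrow> S \<subseteq> carrier A \<and> zero A \<in> S \<and> one A \<in> S \<and>
     (\<forall>x \<in> S. \<forall>y \<in> S. meet A x y \<in> S \<and> join A x y \<in> S \<and> fus A x y \<in> S \<and> imp A x y \<in> S) \<and>
     (\<forall>c \<in> conns L. \<forall>xs \<in> lists S. length xs = arity L c \<longrightarrow> ops A c xs \<in> S)"

definition copy :: "('c, 'a) algebra \<Rightarrow> 'a set \<Rightarrow> ('a \<Rightarrow> 'b) \<Rightarrow> ('c, 'b) algebra" where
  "copy A S h = (let g = inv_into S h in
     \<lparr>carrier = h ` S,
      meet = \<lambda>x y. h (meet A (g x) (g y)),
      join = \<lambda>x y. h (join A (g x) (g y)),
      fus = \<lambda>x y. h (fus A (g x) (g y)),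
      imp = \<lambda>x y. h (imp A (g x) (g y)),
      zero = h (zero A),
      one = h (one A),
      ops = \<lambda>c xs. h (ops A c (map g xs))\<rparr>)"

lemma eval_subuniverse:
  assumes "subuniverse L A S" "range e \<subseteq> S" "\<phi> \<in> formulas L"
  shows "eval A e \<phi> \<in> S"
  using assms(3)
proof induction
  case (Conn c \<phi>s)
  then have "map (eval A e) \<phi>s \<in> lists S" by auto
  with Conn assms(1) show ?case by (simp add: subuniverse_def)
qed (use assms in \<open>auto simp: subuniverse_def\<close>)

lemma eval_copy:
  assumes S: "subuniverse L A S" and inj: "inj_on h S"
    and e: "range e \<subseteq> S" and \<phi>: "\<phi> \<in> formulas L"
  shows "eval (copy A S h) (h \<circ> e) \<phi> = h (eval A e \<phi>)"
proof -
  have g: "inv_into S h (h (eval A e \<psi>)) = eval A e \<psi>" if "\<psi> \<in> formulas L" for \<psi>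
    using eval_subuniverse[OF S e that] inj by simp
  show ?thesis
    using \<phi>
  proof induction
    case (Conn c \<phi>s)
    then have "map (inv_into S h) (map (eval (copy A S h) (h \<circ> e)) \<phi>s) = map (eval A e) \<phi>s"
      using g by (simp add: comp_def)
    moreover have "ops (copy A S h) c xs = h (ops A c (map (inv_into S h) xs))" for xs
      by (simp add: copy_def Let_def)
    ultimately show ?case by (simp only: eval.simps)
  qed (simp_all add: copy_def Let_def g)
qed

lemma le_copy:
  assumes "subuniverse L A S" "inj_on h S" "x \<in> S" "y \<in> S"
  shows "le (copy A S h) (h x) (h y) \<longleftrightarrow> le A x y"
  using assms by (auto simp: le_def copy_def Let_def subuniverse_def inj_on_eq_iff)

lemma mtl_algebra_copy:
  assumes A: "mtl_algebra A" and S: "subuniverse L A S" and inj: "inj_on h S"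
  shows "mtl_algebra (copy A S h)"
proof -
  interpret mtl_algebra A by fact
  have SA: "x \<in> carrier A" if "x \<in> S" for x
    using S that by (auto simp: subuniverse_def)
  have cl: "meet A x y \<in> S" "join A x y \<in> S" "fus A x y \<in> S" "imp A x y \<in> S"
    if "x \<in> S" "y \<in> S" for x y
    using S that by (auto simp: subuniverse_def)
  have cst: "zero A \<in> S" "one A \<in> S"
    using S by (auto simp: subuniverse_def)
  have ops: "meet (copy A S h) (h x) (h y) = h (meet A x y)"
    "join (copy A S h) (h x) (h y) = h (join A x y)"
    "fus (copy A S h) (h x) (h y) = h (fus A x y)"
    "imp (copy A S h) (h x) (h y) = h (imp A x y)"
    if "x \<in> S" "y \<in> S" for x y
    using that inj by (auto simp: copy_def Let_def)
  have csts: "zero (copy A S h) = h (zero A)" "one (copy A S h) = h (one A)"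
    "carrier (copy A S h) = h ` S"
    by (auto simp: copy_def Let_def)
  note le = le_copy[OF S inj]
  show ?thesis
    by unfold_locales
      (auto simp: csts ops cl cst le SA bounds residuation prelinearity lattice(3-6) monoid(2,3),
        simp_all add: lattice(1)[OF SA SA] lattice(2)[OF SA SA] monoid(1)[OF SA SA])
qed

lemma L_chain_copy:
  assumes L: "core_expansion L" and A: "L_chain L A" and S: "subuniverse L A S"
    and inj: "inj_on h S"
  shows "L_chain L (copy A S h)"
proof -
  let ?B = "copy A S h"
  have SA: "S \<subseteq> carrier A" and one: "one A \<in> S"
    using S by (auto simp: subuniverse_def)
  have B: "carrier ?B = h ` S" "one ?B = h (one A)"
    by (auto simp: copy_def Let_def)
  have alg: "L_algebra L A" using A by (simp add: L_chain_def)
  have "mtl_algebra ?B"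
    using alg S inj mtl_algebra_copy by (auto simp: L_algebra_def)
  moreover have "ops ?B c xs \<in> carrier ?B"
    if "c \<in> conns L" "xs \<in> lists (carrier ?B)" "length xs = arity L c" for c xs
  proof -
    have "map (inv_into S h) xs \<in> lists S"
      using that(2) by (auto simp: B in_lists_conv_set inv_into_into)
    then have "ops A c (map (inv_into S h) xs) \<in> S"
      using S that by (auto simp: subuniverse_def)
    then show ?thesis by (simp add: copy_def Let_def)
  qed
  moreover have "(\<forall>\<phi> \<in> axioms L. eval ?B e \<phi> = one ?B) \<and>
      (\<forall>(\<Pi>, \<phi>) \<in> rules L. (\<forall>\<psi> \<in> \<Pi>. eval ?B e \<psi> = one ?B) \<longrightarrow> eval ?B e \<phi> = one ?B)"
    if e: "range e \<subseteq> carrier ?B" for e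
  proof -
    define d where "d = inv_into S h \<circ> e"
    have d: "range d \<subseteq> S" and e_d: "e = h \<circ> d"
      using e by (auto simp: d_def B inv_into_into f_inv_into_f fun_eq_iff image_subset_iff)
    have one_iff: "eval ?B e \<phi> = one ?B \<longleftrightarrow> eval A d \<phi> = one A" if "\<phi> \<in> formulas L" for \<phi>
      using eval_copy[OF S inj d that] eval_subuniverse[OF S d that] one inj
      by (simp add: e_d B inj_on_eq_iff)
    have dA: "range d \<subseteq> carrier A" using d SA by blast
    have ax: "\<forall>\<phi> \<in> axioms L. eval A d \<phi> = one A"
      and rl: "\<forall>(\<Pi>, \<phi>) \<in> rules L. (\<forall>\<psi> \<in> \<Pi>. eval A d \<psi> = one A) \<longrightarrow> eval A d \<phi> = one A"
      using alg dA by (auto simp: L_algebra_def)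
    have "eval ?B e \<phi> = one ?B" if "\<phi> \<in> axioms L" for \<phi>
      using that ax one_iff formulas_axioms[OF L] by auto
    moreover have "eval ?B e \<phi> = one ?B"
      if r: "(\<Pi>, \<phi>) \<in> rules L" and p: "\<forall>\<psi> \<in> \<Pi>. eval ?B e \<psi> = one ?B" for \<Pi> \<phi>
    proof -
      have "\<forall>\<psi> \<in> \<Pi>. eval A d \<psi> = one A"
        using p one_iff formulas_rules(1)[OF L r] by auto
      then have "eval A d \<phi> = one A" using r rl by auto
      then show ?thesis using one_iff formulas_rules(2)[OF L r] by auto
    qed
    ultimately show ?thesis by auto
  qed
  ultimately have "L_algebra L ?B" by (auto simp: L_algebra_def)
  moreover have "le ?B x y \<or> le ?B y x" if B_xy: "x \<in> carrier ?B" "y \<in> carrier ?B" for x y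
  proof -
    obtain x' y' where xy: "x' \<in> S" "y' \<in> S" "x = h x'" "y = h y'"
      using B_xy unfolding B by blast
    then have "le A x' y' \<or> le A y' x'" using A SA unfolding L_chain_def by blast
    then show ?thesis using xy le_copy[OF S inj] by blast
  qed
  ultimately show ?thesis by (simp add: L_chain_def)
qed

lemma subuniverse_eval:
  assumes chain: "L_chain L A" and u: "range u \<subseteq> carrier A"
  shows "subuniverse L A (eval A u ` formulas L)"
proof -
  have A: "L_algebra L A" using chain by (simp add: L_chain_def)
  interpret mtl_algebra A using A by (simp add: L_algebra_def)
  let ?S = "eval A u ` formulas L"
  have "subuniverse L A (carrier A)"
    using A closed by (auto simp: L_algebra_def subuniverse_def)
  then have SA: "?S \<subseteq> carrier A"
    using eval_subuniverse[OF _ u] by blast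
  have zero: "zero A \<in> ?S" by (rule image_eqI[of _ _ Zero]) (auto intro: formulas.intros)
  have bin: "meet A x y \<in> ?S" "fus A x y \<in> ?S" "imp A x y \<in> ?S" if xy: "x \<in> ?S" "y \<in> ?S" for x y
  proof -
    obtain \<phi> \<psi> where fm: "\<phi> \<in> formulas L" "\<psi> \<in> formulas L"
      and eqs: "x = eval A u \<phi>" "y = eval A u \<psi>"
      using xy by blast
    show "meet A x y \<in> ?S"
      by (rule image_eqI[OF _ formulas.And[OF fm]]) (simp add: eqs)
    show "fus A x y \<in> ?S"
      by (rule image_eqI[OF _ formulas.Fus[OF fm]]) (simp add: eqs)
    show "imp A x y \<in> ?S"
      by (rule image_eqI[OF _ formulas.Imp[OF fm]]) (simp add: eqs)
  qed
  have "le A (fus A (one A) (zero A)) (zero A)"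
    using bounds(1) monoid(3) closed(5) by simp
  then have "le A (one A) (imp A (zero A) (zero A))"
    using residuation closed(5,6) by blast
  then have "imp A (zero A) (zero A) = one A"
    using bounds(2) lattice(1) closed(4-6) by (metis le_def)
  then have one: "one A \<in> ?S"
    using bin(3)[OF zero zero] by simp
  have join: "join A x y \<in> ?S" if "x \<in> ?S" "y \<in> ?S" for x y
  proof -
    have xy: "x \<in> carrier A" "y \<in> carrier A" using that SA by auto
    then have "le A x y \<or> le A y x" using chain by (simp add: L_chain_def)
    then have "join A x y = y \<or> join A x y = x"
      using xy lattice(1,2,6) by (metis le_def)
    then show ?thesis using that by auto
  qed
  have "ops A c xs \<in> ?S" if cxs: "c \<in> conns L" "xs \<in> lists ?S" "length xs = arity L c" for c xs
  proof -
    obtain \<phi>s where "set \<phi>s \<subseteq> formulas L" "xs = map (eval A u) \<phi>s"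
      using cxs(2) unfolding lists_image by (auto simp: in_lists_conv_set)
    then show ?thesis
      using cxs formulas.Conn[of c L \<phi>s] by (metis eval.simps(6) image_eqI length_map subsetD)
  qed
  with SA zero one bin join show ?thesis by (auto simp: subuniverse_def)
qed

text \<open>The subalgebra generated by an element and the values of an evaluation has at most as many
  elements as there are formulas, so it has a copy in any type that the formulas embed into.\<close>

lemma L_chain_transfer:
  fixes f :: "'c fm \<Rightarrow> 'b" and L :: "'c logic" and A :: "('c, 'a) algebra"
  assumes L: "core_expansion L" and f: "inj f" and A: "L_chain L A"
    and e: "range e \<subseteq> carrier A" and a: "a \<in> carrier A"
  obtains B :: "('c, 'b) algebra" and h where
    "L_chain L B" "range (h \<circ> e) \<subseteq> carrier B" "h a \<in> carrier B"
    "\<And>\<phi>. \<phi> \<in> formulas L \<Longrightarrow> eval B (h \<circ> e) \<phi> = one B \<longleftrightarrow> eval A e \<phi> = one A"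
    "\<And>\<phi>. \<phi> \<in> formulas L \<Longrightarrow> le B (h a) (eval B (h \<circ> e) \<phi>) \<longleftrightarrow> le A a (eval A e \<phi>)"
proof
  define u where "u = case_nat a e"
  let ?S = "eval A u ` formulas L"
  let ?h = "f \<circ> inv_into (formulas L) (eval A u)"
  let ?B = "copy A ?S ?h"
  have "range u \<subseteq> carrier A"
    using a e by (auto simp: u_def image_subset_iff split: nat.split)
  from subuniverse_eval[OF A this] have S: "subuniverse L A ?S" .
  have inj: "inj_on ?h ?S"
    using f by (intro comp_inj_on inj_on_inv_into) (auto intro: inj_on_subset)
  have aS: "a \<in> ?S"
    by (rule image_eqI[of _ _ "Var 0"]) (auto simp: u_def intro: formulas.intros)
  have "e n \<in> ?S" for n
    by (rule image_eqI[of _ _ "Var (Suc n)"]) (auto simp: u_def intro: formulas.intros)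
  then have eS: "range e \<subseteq> ?S" by blast
  have oneS: "one A \<in> ?S" using S by (simp add: subuniverse_def)
  have B: "carrier ?B = ?h ` ?S" "one ?B = ?h (one A)"
    by (auto simp: copy_def Let_def)
  show "L_chain L ?B" by (rule L_chain_copy[OF L A S inj])
  show "range (?h \<circ> e) \<subseteq> carrier ?B" "?h a \<in> carrier ?B"
    unfolding B using image_mono[OF eS, of ?h] imageI[OF aS, of ?h] by (simp_all only: image_comp)
  fix \<phi> assume \<phi>: "\<phi> \<in> formulas L"
  note ev = eval_copy[OF S inj eS \<phi>] and evS = eval_subuniverse[OF S eS \<phi>]
  show "eval ?B (?h \<circ> e) \<phi> = one ?B \<longleftrightarrow> eval A e \<phi> = one A"
    unfolding ev B by (rule inj_on_eq_iff[OF inj evS oneS])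
  show "le ?B (?h a) (eval ?B (?h \<circ> e) \<phi>) \<longleftrightarrow> le A a (eval A e \<phi>)"
    unfolding ev by (rule le_copy[OF S inj aS evS])
qed

theorem chain_consequence_universal:
  fixes L :: "'c logic" and f :: "'c fm \<Rightarrow> 'b"
  assumes L: "core_expansion L" and f: "inj f"
    and fm: "\<Gamma> \<subseteq> formulas L" "\<phi> \<in> formulas L"
    and cons: "chain_consequence TYPE('b) L \<Gamma> \<phi>"
  shows "chain_consequence TYPE('a) L \<Gamma> \<phi>"
  unfolding chain_consequence_def
proof (intro allI impI)
  fix A :: "('c, 'a) algebra" and e
  assume A: "L_chain L A" and e: "range e \<subseteq> carrier A" and \<Gamma>: "\<forall>\<gamma> \<in> \<Gamma>. eval A e \<gamma> = one A"
  have e0: "e 0 \<in> carrier A" using e by blast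
  obtain B :: "('c, 'b) algebra" and h where B: "L_chain L B" "range (h \<circ> e) \<subseteq> carrier B"
    "h (e 0) \<in> carrier B"
    "\<And>\<phi>. \<phi> \<in> formulas L \<Longrightarrow> eval B (h \<circ> e) \<phi> = one B \<longleftrightarrow> eval A e \<phi> = one A"
    "\<And>\<phi>. \<phi> \<in> formulas L \<Longrightarrow> le B (h (e 0)) (eval B (h \<circ> e) \<phi>) \<longleftrightarrow> le A (e 0) (eval A e \<phi>)"
    by (fact L_chain_transfer[OF L f A e e0])
  have "\<forall>\<gamma> \<in> \<Gamma>. eval B (h \<circ> e) \<gamma> = one B"
    using \<Gamma> B(4) fm(1) by blast
  then have "eval B (h \<circ> e) \<phi> = one B"
    using cons B(1,2) unfolding chain_consequence_def by blast
  then show "eval A e \<phi> = one A" using B(4) fm(2) by blast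
qed

theorem companion_universal:
  fixes L :: "'c logic" and f :: "'c fm \<Rightarrow> 'b"
  assumes L: "core_expansion L" and f: "inj f"
    and fm: "\<Gamma> \<subseteq> formulas L" "\<phi> \<in> formulas L"
    and cons: "companion TYPE('b) L \<Gamma> \<phi>"
  shows "companion TYPE('a) L \<Gamma> \<phi>"
  unfolding companion_def
proof (intro allI ballI impI)
  fix A :: "('c, 'a) algebra" and a v
  assume A: "L_chain L A" and a: "a \<in> carrier A" and v: "range v \<subseteq> carrier A"
    and \<Gamma>: "\<forall>\<psi> \<in> \<Gamma>. le A a (eval A v \<psi>)"
  obtain B :: "('c, 'b) algebra" and h where B: "L_chain L B" "range (h \<circ> v) \<subseteq> carrier B"
    "h a \<in> carrier B"
    "\<And>\<phi>. \<phi> \<in> formulas L \<Longrightarrow> eval B (h \<circ> v) \<phi> = one B \<longleftrightarrow> eval A v \<phi> = one A"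
    "\<And>\<phi>. \<phi> \<in> formulas L \<Longrightarrow> le B (h a) (eval B (h \<circ> v) \<phi>) \<longleftrightarrow> le A a (eval A v \<phi>)"
    by (fact L_chain_transfer[OF L f A v a])
  have "\<forall>\<psi> \<in> \<Gamma>. le B (h a) (eval B (h \<circ> v) \<psi>)"
    using \<Gamma> B(5) fm(1) by blast
  then have "le B (h a) (eval B (h \<circ> v) \<phi>)"
    using cons B(1-3) unfolding companion_def by blast
  then show "le A a (eval A v \<phi>)" using B(5) fm(2) by blast
qed

corollary semilinear_universal:
  fixes L :: "'c logic" and f :: "'c fm \<Rightarrow> 'a" and g :: "'c fm \<Rightarrow> 'b"
  assumes "core_expansion L" "inj f" "inj g"
  shows "semilinear TYPE('a) L \<longleftrightarrow> semilinear TYPE('b) L"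
proof -
  have "chain_consequence TYPE('a) L \<Gamma> \<phi> \<longleftrightarrow> chain_consequence TYPE('b) L \<Gamma> \<phi>"
    if "\<Gamma> \<subseteq> formulas L" "\<phi> \<in> formulas L" for \<Gamma> \<phi>
    by (rule iffI[OF chain_consequence_universal[OF assms(1,2) that]
          chain_consequence_universal[OF assms(1,3) that]])
  then show ?thesis unfolding semilinear_def by blast
qed

end

theory Submission
  imports Defs
begin

text \<open>Explosion of \<open>L\<close> is a matter of two applications of modus ponens, through \<open>\<^bold>0\<close> and the axiom
  \<open>\<^bold>0 \<^bold>\<rightarrow> \<psi>\<close>.

  The companion compares degrees, so for it the two premises \<open>\<phi>\<close> and \<open>\<^bold>\<not> \<phi>\<close> amount to their greatest
  common lower bound \<open>\<phi> \<^bold>\<and> \<^bold>\<not> \<phi>\<close>, and a contradiction entails everything exactly if this value is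
  always \<open>0\<close>. By residuation (\<open>imp_eq_one_iff\<close>), a value is \<open>0\<close> iff its negation is \<open>1\<close>.
  Hence the companion is explosive iff \<open>\<^bold>\<not> (\<phi> \<^bold>\<and> \<^bold>\<not> \<phi>)\<close> is valid in
  all chains (\<open>explosive_companion_iff\<close>), which by semilinearity means that \<open>L\<close> proves it.\<close>

lemma derives_modus_ponens:
  assumes "derives L \<Gamma> \<phi>" "derives L \<Gamma> (\<phi> \<^bold>\<rightarrow> \<psi>)" "\<phi> \<in> formulas L" "\<psi> \<in> formulas L"
  shows "derives L \<Gamma> \<psi>"
proof -
  let ?\<sigma> = "\<lambda>n. if n = 0 then \<phi> else \<psi>"
  have "derives L \<Gamma> (subst ?\<sigma> (Var 1))"
    by (rule derives.rule[of "{Var 0, Var 0 \<^bold>\<rightarrow> Var 1}"])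
      (use assms in \<open>auto simp: rules_def modus_ponens_def\<close>)
  then show ?thesis by simp
qed

lemma derives_ex_falso:
  assumes "\<psi> \<in> formulas L"
  shows "derives L \<Gamma> (\<^bold>0 \<^bold>\<rightarrow> \<psi>)"
proof -
  have "derives L \<Gamma> (subst (\<lambda>_. \<psi>) (\<^bold>0 \<^bold>\<rightarrow> Var 0))"
    using assms by (intro derives.ax) (auto simp: axioms_def mtl_axioms_def Let_def)
  then show ?thesis by simp
qed

lemma explosive_derives: "explosive L (derives L)"
  unfolding explosive_def
proof (intro ballI)
  fix \<phi> \<psi> assume fm: "\<phi> \<in> formulas L" "\<psi> \<in> formulas L"
  have "derives L {\<phi>, \<^bold>\<not> \<phi>} \<^bold>0"
    by (rule derives_modus_ponens[of _ _ \<phi>]) (auto intro: derives.hyp formulas.Zero fm)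
  then show "derives L {\<phi>, \<^bold>\<not> \<phi>} \<psi>"
    by (rule derives_modus_ponens[OF _ derives_ex_falso[OF fm(2)] formulas.Zero fm(2)])
qed

lemma paraconsistent_iff_not_explosive: "paraconsistent L entails \<longleftrightarrow> \<not> explosive L entails"
  by (auto simp: paraconsistent_def explosive_def)

context mtl_algebra
begin

lemma meet_idem: "x \<in> carrier A \<Longrightarrow> meet A x x = x"
  using lattice(5)[of x "meet A x x"] lattice(6)[of x x] closed(1) by simp

lemma le_trans:
  assumes "x \<in> carrier A" "y \<in> carrier A" "z \<in> carrier A" "le A x y" "le A y z"
  shows "le A x z"
  using assms lattice(3)[of x y z] by (simp add: le_def)

lemma le_meet_iff:
  assumes x: "x \<in> carrier A" and y: "y \<in> carrier A" and z: "z \<in> carrier A"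
  shows "le A x (meet A y z) \<longleftrightarrow> le A x y \<and> le A x z"
proof
  have "le A (meet A y z) z"
    using y z by (simp add: le_def lattice(3) meet_idem)
  moreover have "le A (meet A y z) y"
    using y z by (metis calculation closed(1) lattice(1,3) le_def meet_idem)
  moreover assume "le A x (meet A y z)"
  ultimately show "le A x y \<and> le A x z"
    using le_trans x y z closed(1) by blast
next
  assume "le A x y \<and> le A x z"
  then show "le A x (meet A y z)"
    using x y z by (simp add: le_def flip: lattice(3))
qed

lemma imp_eq_one_iff:
  assumes x: "x \<in> carrier A" and y: "y \<in> carrier A"
  shows "imp A x y = one A \<longleftrightarrow> le A x y"
proof -
  have "le A x y \<longleftrightarrow> le A (one A) (imp A x y)"
    using residuation[of "one A" x y] monoid(3) closed(6) x y by simp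
  also have "\<dots> \<longleftrightarrow> imp A x y = one A"
    using bounds(2)[of "imp A x y"] lattice(1)[of "one A" "imp A x y"] closed(4,6) x y
    by (auto simp: le_def)
  finally show ?thesis by simp
qed

text \<open>The meet is itself one of the lower bounds \<open>a\<close>, and it is above all the others.\<close>

lemma neg_contradiction_eq_one_iff:
  assumes x: "x \<in> carrier A"
  shows "imp A (meet A x (imp A x (zero A))) (zero A) = one A \<longleftrightarrow>
    (\<forall>a \<in> carrier A. le A a x \<longrightarrow> le A a (imp A x (zero A)) \<longrightarrow> le A a (zero A))"
proof -
  let ?m = "meet A x (imp A x (zero A))"
  have neg: "imp A x (zero A) \<in> carrier A" using x closed(4,5) by simp
  then have m: "?m \<in> carrier A" using x closed(1) by simp
  have "le A ?m ?m" using meet_idem[OF m] by (simp add: le_def)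
  then have "le A ?m (zero A) \<longleftrightarrow> (\<forall>a \<in> carrier A. le A a ?m \<longrightarrow> le A a (zero A))"
    using m le_trans closed(5) by blast
  then show ?thesis
    using imp_eq_one_iff[OF m closed(5)] le_meet_iff[OF _ x neg] by auto
qed

end

lemma eval_in_carrier:
  assumes A: "L_algebra L A" and v: "range v \<subseteq> carrier A" and \<phi>: "\<phi> \<in> formulas L"
  shows "eval A v \<phi> \<in> carrier A"
proof -
  interpret mtl_algebra A using A by (simp add: L_algebra_def)
  have "subuniverse L A (carrier A)"
    using A closed by (auto simp: L_algebra_def subuniverse_def)
  then show ?thesis using v \<phi> by (rule eval_subuniverse)
qed

text \<open>Since \<open>\<^bold>0\<close> takes the least value, it stands for all conclusions \<open>\<psi>\<close> at once.\<close>

lemma explosive_companion_iff: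
  fixes L :: "'c logic"
  shows "explosive L (companion TYPE('a) L) \<longleftrightarrow>
    (\<forall>\<phi> \<in> formulas L. chain_consequence TYPE('a) L {} (\<^bold>\<not> (\<phi> \<^bold>\<and> \<^bold>\<not> \<phi>)))"
proof (intro iffI ballI)
  fix \<phi> assume \<phi>: "\<phi> \<in> formulas L" and "explosive L (companion TYPE('a) L)"
  then have expl: "companion TYPE('a) L {\<phi>, \<^bold>\<not> \<phi>} \<^bold>0"
    by (simp add: explosive_def formulas.Zero)
  show "chain_consequence TYPE('a) L {} (\<^bold>\<not> (\<phi> \<^bold>\<and> \<^bold>\<not> \<phi>))"
    unfolding chain_consequence_def
  proof (intro allI impI)
    fix A :: "('c, 'a) algebra" and v :: "nat \<Rightarrow> 'a"
    assume A: "L_chain L A" and v: "range v \<subseteq> carrier A"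
    interpret mtl_algebra A using A by (simp add: L_chain_def L_algebra_def)
    have "eval A v \<phi> \<in> carrier A"
      using A v \<phi> by (intro eval_in_carrier[of L]) (simp_all add: L_chain_def)
    then show "eval A v (\<^bold>\<not> (\<phi> \<^bold>\<and> \<^bold>\<not> \<phi>)) = one A"
      using neg_contradiction_eq_one_iff expl A v by (simp add: companion_def)
  qed
next
  assume valid: "\<forall>\<phi> \<in> formulas L. chain_consequence TYPE('a) L {} (\<^bold>\<not> (\<phi> \<^bold>\<and> \<^bold>\<not> \<phi>))"
  show "explosive L (companion TYPE('a) L)"
    unfolding explosive_def companion_def
  proof (intro ballI allI impI)
    fix \<phi> \<psi> and A :: "('c, 'a) algebra" and a and v :: "nat \<Rightarrow> 'a"
    assume fm: "\<phi> \<in> formulas L" "\<psi> \<in> formulas L" and A: "L_chain L A"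
      and a: "a \<in> carrier A" and v: "range v \<subseteq> carrier A"
      and le: "\<forall>\<chi> \<in> {\<phi>, \<^bold>\<not> \<phi>}. le A a (eval A v \<chi>)"
    interpret mtl_algebra A using A by (simp add: L_chain_def L_algebra_def)
    have val: "eval A v \<phi> \<in> carrier A" "eval A v \<psi> \<in> carrier A"
      using A v fm by (auto intro!: eval_in_carrier[of L] simp: L_chain_def)
    have "eval A v (\<^bold>\<not> (\<phi> \<^bold>\<and> \<^bold>\<not> \<phi>)) = one A"
      using valid fm(1) A v unfolding chain_consequence_def by blast
    then have "le A a (zero A)"
      using neg_contradiction_eq_one_iff[OF val(1)] a le by simp
    then show "le A a (eval A v \<psi>)"
      using le_trans[OF a closed(5) val(2)] bounds(1)[OF val(2)] by simp
  qed
qed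

theorem proposition4p1:
  fixes L :: "'c logic"
  assumes "core_expansion L"
    and "semilinear TYPE('a) L"
  shows "(explosive L (derives L) \<and> \<not> paraconsistent L (derives L)) \<and>
    (paraconsistent L (companion TYPE('a) L) \<longleftrightarrow> \<not> pseudo_complemented L)"
proof -
  have "derives L {} (\<^bold>\<not> (\<phi> \<^bold>\<and> \<^bold>\<not> \<phi>)) \<longleftrightarrow> chain_consequence TYPE('a) L {} (\<^bold>\<not> (\<phi> \<^bold>\<and> \<^bold>\<not> \<phi>))"
    if "\<phi> \<in> formulas L" for \<phi>
    using assms(2) that by (simp add: semilinear_def formulas.intros)
  then have "pseudo_complemented L \<longleftrightarrow> explosive L (companion TYPE('a) L)"
    unfolding pseudo_complemented_def explosive_companion_iff by blast
  then show ?thesis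
    using explosive_derives by (simp add: paraconsistent_iff_not_explosive)
qed

end
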